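(* Let $v\in\mathbb{N}$ and let $a_1,\dots,a_m$ be pairwise coprime divisors of $v$. (i) There exists a non-disjoint $\big(v,m,\frac{v}{a_1},\dots,\frac{v}{a_m}\big)$-GPSEDF in $\mathbb{Z}_v$. (ii) Let $\mu_1,\dots,\mu_m$ be integers with $0\le\mu_i\le a_i-1$ for $1\le i\le m$. Then there exists a non-disjoint $\big(v,m,\mu_1\frac{v}{a_1},\dots,\mu_m\frac{v}{a_m}\big)$-GPSEDF in $\mathbb{Z}_v$.
   Context: For subsets $A,B$ of an additively written group $G$, $\Delta(A,B)$ denotes the multiset $\{a-b:a\in A,b\in B\}$ (one entry per pair). For $\lambda\in\mathbb{N}\cup\{0\}$, $\lambda G$ is the multiset containing every element of $G$ exactly $\lambda$ times. Let $|G|=v$. A family of sets $\{A_1,\dots,A_m\}$ in $G$ with $|A_i|=k_i$ is a non-disjoint $(v,m,k_1,\dots,k_m)$-GPSEDF if $\Delta(A_i,A_j)=\lambda_{i,j}G$ with $\lambda_{i,j}=k_ik_j/v$ for all $1\le i\ne j\le m$. *)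

theory Defs
  imports Complex_Main "HOL-Library.Multiset" "HOL-Algebra.Elementary_Groups"
begin

text \<open>
  HOL-Algebra writes every group multiplicatively, so the difference \<open>a - b\<close> of an additively
  written group reads \<open>a \<otimes>\<^bsub>G\<^esub> inv\<^bsub>G\<^esub> b\<close>.  For infinite \<open>A \<times> B\<close> (or infinite \<open>carrier G\<close> below),
  \<open>mset_set\<close> is the empty multiset; these definitions are only used for finite groups.
\<close>

definition Delta :: "('a, 'b) monoid_scheme \<Rightarrow> 'a set \<Rightarrow> 'a set \<Rightarrow> 'a multiset" where
  "Delta G A B = image_mset (\<lambda>(a, b). a \<otimes>\<^bsub>G\<^esub> inv\<^bsub>G\<^esub> b) (mset_set (A \<times> B))"

definition multiple_of_group :: "nat \<Rightarrow> ('a, 'b) monoid_scheme \<Rightarrow> 'a multiset" where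
  "multiple_of_group l G = repeat_mset l (mset_set (carrier G))"

text \<open>
  The family \<open>A 1, \<dots>, A m\<close> is indexed, so repeated members are allowed and compared with each
  other.  The existential over \<open>l\<close> makes integrality of \<open>k i * k j / v\<close> part of the definition.
\<close>

definition nondisjoint_gpsedf ::
    "('a, 'b) monoid_scheme \<Rightarrow> nat \<Rightarrow> nat \<Rightarrow> (nat \<Rightarrow> nat) \<Rightarrow> (nat \<Rightarrow> 'a set) \<Rightarrow> bool" where
  "nondisjoint_gpsedf G v m k A \<longleftrightarrow>
     group G \<and> finite (carrier G) \<and> order G = v \<and>
     (\<forall>i\<in>{1..m}. A i \<subseteq> carrier G \<and> card (A i) = k i) \<and>
     (\<forall>i\<in>{1..m}. \<forall>j\<in>{1..m}. i \<noteq> j \<longrightarrow>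
        (\<exists>l::nat. real l = real (k i) * real (k j) / real v \<and>
           Delta G (A i) (A j) = multiple_of_group l G))"

end

theory Submission
  imports Defs
begin

text \<open>
  Take \<open>A\<^sub>i\<close> to be the union of \<open>c\<^sub>i\<close> residue classes modulo \<open>a\<^sub>i\<close> in \<open>\<int>\<^sub>v\<close>.  A group element \<open>g\<close>
  arises as a difference \<open>x - y\<close> once for each \<open>y\<close> with \<open>y \<in> A\<^sub>j\<close> and \<open>y + g \<in> A\<^sub>i\<close>; by the Chinese
  remainder theorem these two congruence conditions to coprime moduli are independent, so the number
  of such \<open>y\<close> does not depend on \<open>g\<close>.
\<close>

text \<open>Division with remainder writes each \<open>y\<close> uniquely as
  \<open>n * t + e\<close> with \<open>e\<close> in \<open>{0..<n}\<close>. The interval consists of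
  \<open>q\<close> full periods of length \<open>n\<close>, and each period contributes one
  \<open>y\<close> for every \<open>e \<in> E\<close>.\<close>

lemma card_residues_periodic:
  fixes n :: int and q :: nat
  assumes "n > 0" "E \<subseteq> {0..<n}"
  shows "card {y \<in> {0..<n * int q}. y mod n \<in> E} = q * card E"
proof -
  have "bij_betw (\<lambda>y. (y div n, y mod n)) {y \<in> {0..<n * int q}. y mod n \<in> E} ({0..<int q} \<times> E)"
  proof (rule bij_betw_byWitness[where f' = "\<lambda>(t, e). n * t + e"])
    show "(\<lambda>y. (y div n, y mod n)) ` {y \<in> {0..<n * int q}. y mod n \<in> E} \<subseteq> {0..<int q} \<times> E"
    proof -
      have "y div n < int q" if "y < n * int q" for y
      proof -
        have "n * (y div n) \<le> y"
          using assms(1) by (simp flip: minus_mod_eq_mult_div)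
        then have "n * (y div n) < n * int q"
          using that by linarith
        then show ?thesis
          using assms(1) by simp
      qed
      then show ?thesis
        using assms(1) by (auto simp: pos_imp_zdiv_nonneg_iff)
    qed
    show "(\<lambda>(t, e). n * t + e) ` ({0..<int q} \<times> E) \<subseteq> {y \<in> {0..<n * int q}. y mod n \<in> E}"
    proof clarify
      fix t e assume te: "t \<in> {0..<int q}" "e \<in> E"
      then have e: "0 \<le> e" "e < n" and "0 \<le> t" "t + 1 \<le> int q"
        using assms(2) by auto
      \<comment> \<open>Bounding \<open>t + 1\<close> rather than \<open>t\<close> leaves room for
        the remainder \<open>e < n\<close>, also in the last period.\<close>
      then have "n * (t + 1) \<le> n * int q" "0 \<le> n * t"
        using assms(1) by (simp_all add: mult_left_mono)
      then show "n * t + e \<in> {0..<n * int q} \<and> (n * t + e) mod n \<in> E"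
        using e te by (simp add: algebra_simps)
    qed
  qed (use assms in auto)
  then show ?thesis
    by (simp add: bij_betw_same_card card_cartesian_product)
qed

text \<open>Chinese remainder theorem. Coprimality turns equal residue pairs into divisibility of
  the difference by \<open>a * b\<close>, hence injectivity; surjectivity follows because both sides
  have \<open>a * b\<close> elements.\<close>

lemma bij_betw_residue_pair:
  fixes a b :: int
  assumes "a > 0" "b > 0" "coprime a b"
  shows "bij_betw (\<lambda>y. (y mod a, y mod b)) {0..<a * b} ({0..<a} \<times> {0..<b})"
proof -
  have "inj_on (\<lambda>y. (y mod a, y mod b)) {0..<a * b}"
  proof (rule inj_onI)
    fix x y
    assume xy: "x \<in> {0..<a * b}" "y \<in> {0..<a * b}" "(x mod a, x mod b) = (y mod a, y mod b)"
    then have "a * b dvd x - y"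
      using assms(3) by (simp add: divides_mult mod_eq_dvd_iff)
    then have "x mod (a * b) = y mod (a * b)"
      by (simp add: mod_eq_dvd_iff)
    then show "x = y"
      using xy(1,2) by simp
  qed
  moreover have "(\<lambda>y. (y mod a, y mod b)) ` {0..<a * b} \<subseteq> {0..<a} \<times> {0..<b}"
    using assms by auto
  moreover have "card {0..<a * b} = card ({0..<a} \<times> {0..<b})"
    using assms by (simp add: card_cartesian_product nat_mult_distrib)
  ultimately show ?thesis
    by (simp add: bij_betw_def card_image card_subset_eq)
qed

text \<open>The two congruence conditions amount to one condition modulo \<open>a * b\<close>. By
  the Chinese remainder theorem \<open>card C * card D\<close> residues satisfy it, and each of them
  recurs in all \<open>q\<close> periods.\<close>

lemma card_residue_pair:
  fixes a b :: int and q :: nat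
  assumes "a > 0" "b > 0" "coprime a b" "C \<subseteq> {0..<a}" "D \<subseteq> {0..<b}"
  shows "card {y \<in> {0..<a * b * int q}. y mod a \<in> C \<and> y mod b \<in> D} = q * (card C * card D)"
proof -
  let ?f = "\<lambda>y. (y mod a, y mod b)"
  define E where "E = {y \<in> {0..<a * b}. ?f y \<in> C \<times> D}"
  have bij: "bij_betw ?f {0..<a * b} ({0..<a} \<times> {0..<b})"
    using assms by (intro bij_betw_residue_pair)
  have "?f ` E = C \<times> D"
  proof
    show "C \<times> D \<subseteq> ?f ` E"
    proof
      fix p assume p: "p \<in> C \<times> D"
      then have "p \<in> ?f ` {0..<a * b}"
        using assms(4,5) bij by (auto simp: bij_betw_def)
      then show "p \<in> ?f ` E"
        using p by (auto simp: E_def)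
    qed
  qed (auto simp: E_def)
  moreover have "inj_on ?f E"
    using bij by (auto simp: bij_betw_def E_def intro: inj_on_subset)
  ultimately have "card E = card C * card D"
    by (metis card_image card_cartesian_product)
  \<comment> \<open>Reducing modulo \<open>a * b\<close> first changes neither the residue modulo
    \<open>a\<close> nor the one modulo \<open>b\<close>.\<close>
  moreover have "{y \<in> {0..<a * b * int q}. y mod a \<in> C \<and> y mod b \<in> D}
      = {y \<in> {0..<a * b * int q}. y mod (a * b) \<in> E}"
    using assms(1,2) by (auto simp: E_def mod_mult2_eq mod_mod_cancel)
  moreover have "E \<subseteq> {0..<a * b}"
    by (auto simp: E_def)
  ultimately show ?thesis
    using card_residues_periodic[of "a * b" E q] assms(1,2) by simp
qed

text \<open>Translation by \<open>g\<close> permutes the residues modulo \<open>a\<close>, so the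
  shift can be moved from \<open>y\<close> to \<open>C\<close>: the translate \<open>C'\<close> of
  \<open>C\<close> by \<open>- g\<close> has the same size. Hence the count is independent of
  \<open>g\<close>.\<close>

lemma card_residue_pair_shift:
  fixes a b g :: int and q :: nat
  assumes "a > 0" "b > 0" "coprime a b" "C \<subseteq> {0..<a}" "D \<subseteq> {0..<b}"
  shows "card {y \<in> {0..<a * b * int q}. (y + g) mod a \<in> C \<and> y mod b \<in> D} = q * (card C * card D)"
proof -
  define C' where "C' = (\<lambda>c. (c - g) mod a) ` C"
  have "inj_on (\<lambda>c. (c - g) mod a) C"
  proof (rule inj_onI)
    fix x y assume "x \<in> C" "y \<in> C" and "(x - g) mod a = (y - g) mod a"
    then have "x mod a = y mod a"
      by (simp add: mod_eq_dvd_iff)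
    then show "x = y"
      using \<open>x \<in> C\<close> \<open>y \<in> C\<close> assms(4) by (auto simp: subset_iff)
  qed
  then have "card C' = card C"
    by (simp add: C'_def card_image)
  moreover have "(y + g) mod a \<in> C \<longleftrightarrow> y mod a \<in> C'" for y
  proof
    assume "(y + g) mod a \<in> C"
    moreover have "y mod a = ((y + g) mod a - g) mod a"
      by (simp add: mod_diff_left_eq)
    ultimately show "y mod a \<in> C'"
      unfolding C'_def by (rule rev_image_eqI)
  next
    assume "y mod a \<in> C'"
    then obtain c where c: "c \<in> C" "y mod a = (c - g) mod a"
      by (auto simp: C'_def)
    then have "(y + g) mod a = c mod a"
      by (metis diff_add_cancel mod_add_left_eq)
    then show "(y + g) mod a \<in> C"
      using c(1) assms(4) by (auto simp: subset_iff)
  qed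
  moreover have "C' \<subseteq> {0..<a}"
    using assms(1) by (auto simp: C'_def)
  ultimately show ?thesis
    using card_residue_pair[of a b C' D q] assms by simp
qed

text \<open>For \<open>a dvd v\<close> and \<open>c \<le> a\<close> this is a union of
  \<open>c\<close> cosets of the subgroup of multiples of \<open>a\<close>; the representatives
  \<open>0, ..., c - 1\<close> are an arbitrary choice. The case \<open>c = 1\<close> is the
  subgroup itself.\<close>

definition residue_union :: "nat \<Rightarrow> nat \<Rightarrow> nat \<Rightarrow> int set" where
  "residue_union v a c = {x \<in> {0..<int v}. x mod int a \<in> {0..<int c}}"

lemma residue_union_subset: "residue_union v a c \<subseteq> {0..<int v}"
  by (auto simp: residue_union_def)

lemma card_residue_union:
  assumes "v > 0" "a dvd v" "c \<le> a"
  shows "card (residue_union v a c) = c * (v div a)"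
proof -
  have "int v = int a * int (v div a)"
    using assms(2) by (metis dvd_mult_div_cancel of_nat_mult)
  moreover have "a > 0"
    using assms(1,2) by (auto intro: Nat.gr0I)
  ultimately show ?thesis
    using card_residues_periodic[of "int a" "{0..<int c}" "v div a"] assms(3)
    by (simp add: residue_union_def mult.commute)
qed

lemma count_Delta:
  assumes "finite A" "finite B"
  shows "count (Delta G A B) g = card {(x, y) \<in> A \<times> B. x \<otimes>\<^bsub>G\<^esub> inv\<^bsub>G\<^esub> y = g}"
proof -
  have "{p \<in> A \<times> B. (case p of (x, y) \<Rightarrow> x \<otimes>\<^bsub>G\<^esub> inv\<^bsub>G\<^esub> y) = g}
      = {(x, y) \<in> A \<times> B. x \<otimes>\<^bsub>G\<^esub> inv\<^bsub>G\<^esub> y = g}"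
    by auto
  then show ?thesis
    using assms by (simp add: Delta_def count_conv_size_mset filter_mset_image_mset)
qed

text \<open>For \<open>y\<close> in the carrier the inverse is \<open>(- y) mod int v\<close>, and
  this inner reduction is absorbed by the outer one.\<close>

lemma integer_mod_group_diff:
  assumes "v > 0" "y \<in> {0..<int v}"
  shows "x \<otimes>\<^bsub>integer_mod_group v\<^esub> inv\<^bsub>integer_mod_group v\<^esub> y = (x - y) mod int v"
  using assms by (simp add: inv_integer_mod_group mult_integer_mod_group carrier_integer_mod_group
      mod_add_right_eq)

lemma Delta_residue_union:
  assumes v: "v > 0" and "a dvd v" "b dvd v" "coprime a b" "c \<le> a" "d \<le> b"
  shows "Delta (integer_mod_group v) (residue_union v a c) (residue_union v b d)
    = multiple_of_group (v div (a * b) * (c * d)) (integer_mod_group v)" (is "?L = ?R")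
proof (rule multiset_eqI)
  fix g
  let ?A = "residue_union v a c" and ?B = "residue_union v b d"
  have "a > 0" "b > 0"
    using assms by (auto intro: Nat.gr0I)
  \<comment> \<open>Coprimality makes \<open>{0..<int v}\<close> a whole number of periods of length
    \<open>a * b\<close>, so that the counting lemmas apply with
    \<open>q = v div (a * b)\<close>.\<close>
  have "a * b dvd v"
    using assms by (simp add: divides_mult)
  then have v_eq: "int v = int a * int b * int (v div (a * b))"
    by (metis dvd_mult_div_cancel of_nat_mult)
  have fin: "finite ?A" "finite ?B"
    by (auto intro: finite_subset[OF residue_union_subset])
  have L: "count ?L g = card {(x, y) \<in> ?A \<times> ?B. (x - y) mod int v = g}"
    unfolding count_Delta[OF fin]
    using v residue_union_subset[of v b d]
    by (intro arg_cong[where f = card]) (auto simp: integer_mod_group_diff subset_iff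
        simp del: mult_integer_mod_group)
  show "count ?L g = count ?R g"
  proof (cases "g \<in> {0..<int v}")
    case True
    define Y where "Y = {y \<in> {0..<int v}. (y + g) mod int a \<in> {0..<int c} \<and> y mod int b \<in> {0..<int d}}"
    \<comment> \<open>Wrapping around modulo \<open>v\<close> does not affect membership in a
      residue class modulo \<open>a\<close>.\<close>
    have *: "(z mod int v) mod int a = z mod int a" for z
      using \<open>a dvd v\<close> by (simp add: mod_mod_cancel)
    \<comment> \<open>The second entry determines the pair, since \<open>x\<close> must be
      \<open>(y + g) mod int v\<close>; the condition \<open>x \<in> ?A\<close> then becomes the
      first congruence in \<open>Y\<close>.\<close>
    have "bij_betw snd {(x, y) \<in> ?A \<times> ?B. (x - y) mod int v = g} Y"
    proof (rule bij_betw_byWitness[where f' = "\<lambda>y. ((y + g) mod int v, y)"])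
      have x: "(y + g) mod int v = x" if "(x - y) mod int v = g" "x \<in> {0..<int v}" for x y
        using that by (auto simp: mod_add_right_eq)
      then show "\<forall>p\<in>{(x, y) \<in> ?A \<times> ?B. (x - y) mod int v = g}. ((snd p + g) mod int v, snd p) = p"
        by (auto simp: residue_union_def)
      show "snd ` {(x, y) \<in> ?A \<times> ?B. (x - y) mod int v = g} \<subseteq> Y"
      proof clarsimp
        fix x y assume xy: "x \<in> ?A" "y \<in> ?B" "g = (x - y) mod int v"
        then have "(y + g) mod int v = x"
          using x residue_union_subset by blast
        then have "(y + g) mod int a = x mod int a"
          using *[of "y + g"] by simp
        then show "y \<in> Y"
          using xy by (simp add: residue_union_def Y_def)
      qed
      show "(\<lambda>y. ((y + g) mod int v, y)) ` Y \<subseteq> {(x, y) \<in> ?A \<times> ?B. (x - y) mod int v = g}"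
        using v True by (auto simp: Y_def residue_union_def * mod_diff_left_eq)
    qed simp
    then have "count ?L g = card Y"
      by (simp add: L bij_betw_same_card)
    also have "card Y = v div (a * b) * (c * d)"
      using card_residue_pair_shift[of "int a" "int b" "{0..<int c}" "{0..<int d}" "v div (a * b)" g]
        \<open>a > 0\<close> \<open>b > 0\<close> assms v_eq by (simp add: Y_def)
    also have "\<dots> = count ?R g"
      using True v by (simp add: multiple_of_group_def carrier_integer_mod_group)
    finally show ?thesis .
  next
    case False
    \<comment> \<open>Reduced differences lie in \<open>{0..<int v}\<close>, so outside the carrier
      both multiplicities are zero.\<close>
    then have none: "{(x, y) \<in> ?A \<times> ?B. (x - y) mod int v = g} = {}"
      using v by auto
    show ?thesis
      using False v unfolding L none by (simp add: multiple_of_group_def carrier_integer_mod_group)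
  qed
qed

text \<open>Common source of both parts of the theorem: the numbers \<open>c i\<close> of residue
  classes can be chosen independently, because the difference condition involves only two coprime
  moduli at a time.\<close>

lemma nondisjoint_gpsedf_residue_union:
  assumes v: "v > 0" and dvd: "\<forall>i\<in>{1..m}. a i dvd v"
    and coprime: "pairwise (\<lambda>i j. coprime (a i) (a j)) {1..m}"
    and c: "\<forall>i\<in>{1..m}. c i \<le> a i"
  shows "nondisjoint_gpsedf (integer_mod_group v) v m (\<lambda>i. c i * (v div a i))
    (\<lambda>i. residue_union v (a i) (c i))"
  unfolding nondisjoint_gpsedf_def
proof (intro conjI ballI impI)
  fix i j assume ij: "i \<in> {1..m}" "j \<in> {1..m}" "i \<noteq> j"
  then have "coprime (a i) (a j)"
    using coprime by (simp add: pairwise_def)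
  moreover from this have dvd2: "a i * a j dvd v"
    using ij dvd by (simp add: divides_mult)
  ultimately have "Delta (integer_mod_group v) (residue_union v (a i) (c i)) (residue_union v (a j) (c j))
      = multiple_of_group (v div (a i * a j) * (c i * c j)) (integer_mod_group v)"
    using ij v dvd c by (intro Delta_residue_union) auto
  \<comment> \<open>All the integer divisions here are exact, so both sides equal
    \<open>c i * c j * v / (a i * a j)\<close> as real numbers.\<close>
  moreover have "real (v div (a i * a j) * (c i * c j))
      = real (c i * (v div a i)) * real (c j * (v div a j)) / real v"
    using ij v dvd dvd2 by (simp add: real_of_nat_div field_simps)
  ultimately show "\<exists>l::nat. real l = real (c i * (v div a i)) * real (c j * (v div a j)) / real v \<and>
      Delta (integer_mod_group v) (residue_union v (a i) (c i)) (residue_union v (a j) (c j))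
        = multiple_of_group l (integer_mod_group v)"
    by blast
qed (use assms residue_union_subset in
    \<open>auto simp: carrier_integer_mod_group order_def card_residue_union\<close>)

theorem theorem3p10:
  fixes v m :: nat and a :: "nat \<Rightarrow> nat"
  assumes "v > 0"
    and "\<forall>i\<in>{1..m}. a i dvd v"
    and "pairwise (\<lambda>i j. coprime (a i) (a j)) {1..m}"
  shows "(\<exists>A. nondisjoint_gpsedf (integer_mod_group v) v m (\<lambda>i. v div a i) A) \<and>
         (\<forall>\<mu> :: nat \<Rightarrow> int. (\<forall>i\<in>{1..m}. 0 \<le> \<mu> i \<and> \<mu> i \<le> int (a i) - 1) \<longrightarrow>
            (\<exists>A. nondisjoint_gpsedf (integer_mod_group v) v m
                   (\<lambda>i. nat (\<mu> i) * (v div a i)) A))"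
proof (intro conjI allI impI)
  \<comment> \<open>Part (i) uses one residue class for each modulus; a divisor of the positive
    \<open>v\<close> is at least 1, so such a class exists.\<close>
  have "\<forall>i\<in>{1..m}. 1 \<le> a i"
    using assms(1,2) by (auto simp: Suc_le_eq intro: dvd_pos_nat)
  then show "\<exists>A. nondisjoint_gpsedf (integer_mod_group v) v m (\<lambda>i. v div a i) A"
    using nondisjoint_gpsedf_residue_union[OF assms, of "\<lambda>_. 1"] by auto
next
  fix \<mu> :: "nat \<Rightarrow> int"
  assume "\<forall>i\<in>{1..m}. 0 \<le> \<mu> i \<and> \<mu> i \<le> int (a i) - 1"
  \<comment> \<open>Part (ii) takes \<open>nat (\<mu> i)\<close> classes modulo \<open>a i\<close>;
    the value 0 gives the empty set, for which every multiplicity is zero.\<close>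
  then have "\<forall>i\<in>{1..m}. nat (\<mu> i) \<le> a i"
    by auto
  then show "\<exists>A. nondisjoint_gpsedf (integer_mod_group v) v m (\<lambda>i. nat (\<mu> i) * (v div a i)) A"
    using nondisjoint_gpsedf_residue_union[OF assms, of "\<lambda>i. nat (\<mu> i)"] by auto
qed

end
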